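(* Let $V$ be a set of $n\ge 2$ items, let $T\ge 1$ be an integer, and let $s_1,\dots,s_T:V\to\{0,1\}$ be an arbitrary sequence. Let $\mathrm{SortProc}$ be either $\mathrm{QuickSort}$ or $\mathrm{PlackettLuce}$, and run $\mathrm{OnlineRank}$ for $T$ steps on the feedback $s_1,\dots,s_T$ with learning rate $\eta=n\sqrt{\log 2}/\sqrt{TM}$, where $M$ is specified in each case below. Then: 1. (General case) If $T\ge 4\log 2$ and $M=n^2/4$, then $\mathbb{E}[L_T(\mathrm{OnlineRank})]\le L_T(\pi^* )+\frac{n^2}{2}\sqrt{T\log 2}$. 2. ($k$-choice case) If $1\le k\le n/2$ is an integer such that $|\{u\in V: s_t(u)=1\}|\le k$ for all $t$, $T\ge nk^{-1}\log 2$, and $M=nk$, then $\mathbb{E}[L_T(\mathrm{OnlineRank})]\le L_T(\pi^* )+n^{3/2}\sqrt{Tk\log 2}$. 3. (Single choice case) If $|\{u\in V:s_t(u)=1\}|=1$ for all $t$, $T\ge n\log 2$, and $M=n$, then $\mathbb{E}[L_T(\mathrm{OnlineRank})]\le L_T(\pi^* )+n^{3/2}\sqrt{T\log 2}$. Expectations are over the internal randomness of the algorithm.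
   Context: $\log$ is the natural logarithm. A ranking of $V$ is a bijection $\pi:V\to[n]=\{1,\dots,n\}$; $S(V)$ is the set of rankings; $\pi(v)$ is the position of $v$. Write $u\prec_\pi v$ if $\pi(u)<\pi(v)$, and $[u,v]_\pi\in\{0,1\}$ for the indicator of $u\prec_\pi v$. Let $[x]_+=\max(x,0)$. Game: at each step $t=1,\dots,T$ the algorithm outputs a (possibly random) ranking $\pi_t\in S(V)$ and then observes $s_t:V\to\{0,1\}$ (the indicator of a subset of chosen items). The pairwise loss is $$\ell\ell(\pi,s)=\sum_{(u,v):\,u\ne v}[u,v]_\pi\,[s(v)-s(u)]_+ ,$$ summed over ordered pairs of distinct elements of $V$. The total loss of the algorithm is $L_T(\mathrm{OnlineRank})=\sum_{t=1}^T\ell\ell(\pi_t,s_t)$; for a fixed ranking $\pi$, $L_T(\pi)=\sum_{t=1}^T\ell\ell(\pi,s_t)$; and $\pi^*\in\arg\min_{\pi\in S(V)}L_T(\pi)$. Algorithm $\mathrm{OnlineRank}(V,\eta,\mathrm{SortProc},T)$: set $w_0(u)=0$ for all $u\in V$. For $t=1,\dots,T$: output $\pi_t=\mathrm{SortProc}(V,w_{t-1})$, using fresh randomness; observe $s_t$; set $w_t(u)=w_{t-1}(u)+\eta s_t(u)$ for all $u\in V$. $\mathrm{QuickSort}(V,w)$, for $w:V\to\mathbb{R}$: if $V=\emptyset$ return the empty list. Otherwise choose a pivot $p\in V$ uniformly at random; independently for each $v\in V\setminus\{p\}$, put $v$ in $V_L$ with probability $e^{w(v)}/(e^{w(v)}+e^{w(p)})$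 and otherwise in $V_R$; return the concatenation of $\mathrm{QuickSort}(V_L,w)$, $p$, $\mathrm{QuickSort}(V_R,w)$, regarded as a ranking (the first element has position $1$, and so on), where the recursive calls use independent randomness. $\mathrm{PlackettLuce}(V,w)$: start with $U=V$. For $i=1,\dots,n$: choose a random $u\in U$ with probability proportional to $e^{w(u)}$, set $\pi(u)=i$, and remove $u$ from $U$. Return $\pi$. *)

theory Defs
  imports "HOL-Probability.Probability"
begin

text \<open>Rankings are undefined outside \<open>V\<close>, so that a ranking is determined by its values on \<open>V\<close>.\<close>

definition rankings :: "'a set \<Rightarrow> ('a \<Rightarrow> nat) set" where
  "rankings V = {\<pi> \<in> extensional V. bij_betw \<pi> V {1..card V}}"

definition pairwise_loss :: "'a set \<Rightarrow> ('a \<Rightarrow> nat) \<Rightarrow> ('a \<Rightarrow> real) \<Rightarrow> real" where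
  "pairwise_loss V \<pi> s =
     (\<Sum>(u, v)\<in>{(u, v). u \<in> V \<and> v \<in> V \<and> u \<noteq> v}. of_bool (\<pi> u < \<pi> v) * max (s v - s u) 0)"

definition total_loss :: "'a set \<Rightarrow> (nat \<Rightarrow> 'a \<Rightarrow> real) \<Rightarrow> nat \<Rightarrow> (nat \<Rightarrow> 'a \<Rightarrow> nat) \<Rightarrow> real" where
  "total_loss V s T \<pi>s = (\<Sum>t=1..T. pairwise_loss V (\<pi>s t) (s t))"

text \<open>The ranking described by a duplicate-free list enumerating \<open>V\<close>: the position of \<open>v\<close> is one
  more than the number of elements preceding it.\<close>

definition list_ranking :: "'a set \<Rightarrow> 'a list \<Rightarrow> 'a \<Rightarrow> nat" where
  "list_ranking V xs = restrict (\<lambda>v. Suc (length (takeWhile (\<lambda>x. x \<noteq> v) xs))) V"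

text \<open>The function \<open>left\<close> records which of the elements other than the pivot go to the left part.
  Infinite sets are given a dummy value to make the recursion total.\<close>

function quicksort_list :: "'a set \<Rightarrow> ('a \<Rightarrow> real) \<Rightarrow> 'a list pmf" where
  "quicksort_list V w =
     (if V = {} \<or> infinite V then return_pmf []
      else do {
        p \<leftarrow> pmf_of_set V;
        left \<leftarrow> Pi_pmf (V - {p}) False
                  (\<lambda>v. bernoulli_pmf (exp (w v) / (exp (w v) + exp (w p))));
        xs \<leftarrow> quicksort_list {v \<in> V - {p}. left v} w;
        ys \<leftarrow> quicksort_list {v \<in> V - {p}. \<not> left v} w;
        return_pmf (xs @ p # ys)
      })"
  by pat_completeness auto
termination
  by (relation "Wellfounded.measure (\<lambda>(V, w). card V)") (auto intro!: psubset_card_mono)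

definition quicksort :: "'a set \<Rightarrow> ('a \<Rightarrow> real) \<Rightarrow> ('a \<Rightarrow> nat) pmf" where
  "quicksort V w = map_pmf (list_ranking V) (quicksort_list V w)"

definition exp_choice :: "'a set \<Rightarrow> ('a \<Rightarrow> real) \<Rightarrow> 'a pmf" where
  "exp_choice U w = embed_pmf (\<lambda>u. if u \<in> U then exp (w u) / (\<Sum>x\<in>U. exp (w x)) else 0)"

lemma pmf_exp_choice:
  assumes "finite U" "U \<noteq> {}"
  shows "pmf (exp_choice U w) u = (if u \<in> U then exp (w u) / (\<Sum>x\<in>U. exp (w x)) else 0)"
proof -
  let ?Z = "\<Sum>x\<in>U. exp (w x)"
  let ?f = "\<lambda>u. if u \<in> U then exp (w u) / ?Z else 0"
  have Z: "?Z > 0"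
    using assms by (intro sum_pos) auto
  have "(\<integral>\<^sup>+ u. ennreal (?f u) \<partial>count_space UNIV) = (\<integral>\<^sup>+ u. ennreal (exp (w u) / ?Z) \<partial>count_space U)"
    by (subst nn_integral_count_space_indicator) (auto intro!: nn_integral_cong)
  also have "\<dots> = (\<Sum>u\<in>U. ennreal (exp (w u) / ?Z))"
    using assms by (simp add: nn_integral_count_space_finite)
  also have "\<dots> = ennreal (\<Sum>u\<in>U. exp (w u) / ?Z)"
    using Z by (intro sum_ennreal) auto
  also have "(\<Sum>u\<in>U. exp (w u) / ?Z) = 1"
    using Z by (simp flip: sum_divide_distrib)
  finally show ?thesis
    using Z unfolding exp_choice_def by (subst pmf_embed_pmf) auto
qed

lemma set_pmf_exp_choice:
  assumes "finite U" "U \<noteq> {}"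
  shows "set_pmf (exp_choice U w) = U"
proof -
  have "(\<Sum>x\<in>U. exp (w x)) > 0"
    using assms by (intro sum_pos) auto
  then show ?thesis
    using assms by (auto simp: set_pmf_eq pmf_exp_choice)
qed

text \<open>The list of the items in the order in which they are chosen, so that the item chosen in
  round \<open>i\<close> gets position \<open>i\<close>.\<close>

function plackett_luce_list :: "'a set \<Rightarrow> ('a \<Rightarrow> real) \<Rightarrow> 'a list pmf" where
  "plackett_luce_list U w =
     (if U = {} \<or> infinite U then return_pmf []
      else do {
        u \<leftarrow> exp_choice U w;
        us \<leftarrow> plackett_luce_list (U - {u}) w;
        return_pmf (u # us)
      })"
  by pat_completeness auto
termination
  by (relation "Wellfounded.measure (\<lambda>(U, w). card U)")
     (auto simp: set_pmf_exp_choice intro!: psubset_card_mono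
           simp del: card_Diff_insert card_Diff_singleton)

definition plackett_luce :: "'a set \<Rightarrow> ('a \<Rightarrow> real) \<Rightarrow> ('a \<Rightarrow> nat) pmf" where
  "plackett_luce V w = map_pmf (list_ranking V) (plackett_luce_list V w)"

text \<open>Unconditional recursion equations would make the simplifier loop.\<close>

declare quicksort_list.simps [simp del] plackett_luce_list.simps [simp del]

primrec weights :: "real \<Rightarrow> (nat \<Rightarrow> 'a \<Rightarrow> real) \<Rightarrow> nat \<Rightarrow> 'a \<Rightarrow> real" where
  "weights \<eta> s 0 = (\<lambda>u. 0)"
| "weights \<eta> s (Suc t) = (\<lambda>u. weights \<eta> s t u + \<eta> * s (Suc t) u)"

text \<open>The joint distribution of the rankings output in steps \<open>1, \<dots>, T\<close>. The weights depend only on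
  the feedback, not on the rankings output so far, so fresh randomness in every step amounts to a
  product distribution.\<close>

definition online_rank ::
  "'a set \<Rightarrow> real \<Rightarrow> ('a set \<Rightarrow> ('a \<Rightarrow> real) \<Rightarrow> ('a \<Rightarrow> nat) pmf) \<Rightarrow> (nat \<Rightarrow> 'a \<Rightarrow> real) \<Rightarrow> nat
     \<Rightarrow> (nat \<Rightarrow> 'a \<Rightarrow> nat) pmf" where
  "online_rank V \<eta> sort_proc s T =
     Pi_pmf {1..T} undefined (\<lambda>t. sort_proc V (weights \<eta> s (t - 1)))"

definition learning_rate :: "nat \<Rightarrow> nat \<Rightarrow> real \<Rightarrow> real" where
  "learning_rate n T M = real n * sqrt (ln 2) / sqrt (real T * M)"

end

theory Submission
  imports Defs
begin

text \<open>
  Both sorting procedures place \<open>u\<close> before \<open>v\<close> with probability exactly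
  \<open>e\<^sup>w\<^sup>(\<^sup>u\<^sup>) / (e\<^sup>w\<^sup>(\<^sup>u\<^sup>) + e\<^sup>w\<^sup>(\<^sup>v\<^sup>))\<close>. Since the loss is a sum over pairs, the expected loss is that of running
  exponential weights separately for every pair of items, with \<open>u\<close> and \<open>v\<close> as the two experts and
  gains \<open>s t u\<close> and \<open>s t v\<close>. The potential \<open>ln (1 + e\<^sup>x)\<close>, evaluated at the weight difference, bounds
  the regret of a pair by \<open>ln 2 / \<eta> + \<eta> / 8 * (\<Sum>t. (s t v - s t u)\<^sup>2)\<close>. There are at most \<open>n\<^sup>2 / 2\<close> pairs,
  and \<open>k (n - k)\<close> of them are split by a feedback that chooses \<open>k\<close> items; this number is at most \<open>M\<close>.
\<close>

section \<open>Order of two elements in a list, and pairwise probabilities\<close>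

definition precedes :: "'a \<Rightarrow> 'a \<Rightarrow> 'a list \<Rightarrow> bool" where
  "precedes u v xs \<longleftrightarrow> length (takeWhile (\<lambda>x. x \<noteq> u) xs) < length (takeWhile (\<lambda>x. x \<noteq> v) xs)"

text \<open>The Bradley-Terry probability that \<open>u\<close> beats \<open>v\<close>, in other
  words the logistic function at \<open>w u - w v\<close>.\<close>

definition bt_prob :: "('a \<Rightarrow> real) \<Rightarrow> 'a \<Rightarrow> 'a \<Rightarrow> real" where
  "bt_prob w u v = exp (w u) / (exp (w u) + exp (w v))"

lemma length_takeWhile_neq_less: "u \<in> set xs \<Longrightarrow> length (takeWhile (\<lambda>x. x \<noteq> u) xs) < length xs"
  by (induction xs) auto

lemma takeWhile_neq_eq: "v \<notin> set xs \<Longrightarrow> takeWhile (\<lambda>x. x \<noteq> v) xs = xs"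
  by (induction xs) auto

text \<open>Like \<open>list_ranking\<close>, \<open>precedes\<close> counts preceding entries, so
  an element missing from a list counts as lying after all its entries. With this convention the
  formula also covers lists that contain only one of the two elements.\<close>

lemma precedes_append:
  "precedes u v (xs @ ys) \<longleftrightarrow>
     (if u \<in> set xs then v \<in> set xs \<longrightarrow> precedes u v xs else v \<notin> set xs \<and> precedes u v ys)"
proof -
  have *: "length (takeWhile (\<lambda>x. x \<noteq> z) (xs @ ys)) =
      (if z \<in> set xs then length (takeWhile (\<lambda>x. x \<noteq> z) xs)
       else length xs + length (takeWhile (\<lambda>x. x \<noteq> z) ys))" for z
    by (auto simp: takeWhile_append takeWhile_neq_eq)
  show ?thesis
    using length_takeWhile_neq_less[of u xs] length_takeWhile_neq_less[of v xs]
    unfolding precedes_def * by auto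
qed

lemma precedes_Cons:
  "u \<noteq> v \<Longrightarrow> precedes u v (x # xs) \<longleftrightarrow> x = u \<or> x \<noteq> v \<and> precedes u v xs"
  by (auto simp: precedes_def)

lemma bt_prob_nonneg: "0 \<le> bt_prob w u v"
  and bt_prob_le_1: "bt_prob w u v \<le> 1"
  by (auto simp: bt_prob_def divide_simps add_pos_pos)

lemma bt_prob_commute: "bt_prob w v u = 1 - bt_prob w u v"
  by (simp add: bt_prob_def field_simps add_pos_pos add_nonneg_eq_0_iff)

section \<open>Boolean distributions and independent coordinates\<close>

lemma bool_pmf_eqI: "pmf p True = pmf q True \<Longrightarrow> p = q"
  for p q :: "bool pmf"
  by (rule pmf_eqI) (metis (full_types) pmf_False_conv_True)

lemma map_Not_bernoulli_pmf:
  "0 \<le> p \<Longrightarrow> p \<le> 1 \<Longrightarrow> map_pmf Not (bernoulli_pmf p) = bernoulli_pmf (1 - p)"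
  by (rule bool_pmf_eqI) (simp add: map_pmf_def pmf_bind)

text \<open>Splitting off coordinate \<open>u\<close> leaves a product over \<open>A - {u}\<close>,
  of which only the component \<open>v\<close> is read. This extracts the two independent coins that
  decide the sides of \<open>u\<close> and \<open>v\<close> relative to a pivot.\<close>

lemma map_Pi_pmf_two_components:
  assumes "finite A" "u \<in> A" "v \<in> A" "u \<noteq> v"
  shows "map_pmf (\<lambda>f. (f u, f v)) (Pi_pmf A d p) = pair_pmf (p u) (p v)"
proof -
  have A: "A = insert u (A - {u})" using assms by auto
  have "map_pmf (\<lambda>f. (f u, f v)) (Pi_pmf A d p) =
      map_pmf (\<lambda>(y, f). (y, f v)) (pair_pmf (p u) (Pi_pmf (A - {u}) d p))"
    using assms by (subst A, subst Pi_pmf_insert)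
      (auto simp: pmf.map_comp o_def case_prod_unfold)
  also have "\<dots> = pair_pmf (map_pmf (\<lambda>x. x) (p u)) (map_pmf (\<lambda>f. f v) (Pi_pmf (A - {u}) d p))"
    by (subst map_pair) (auto simp: map_prod_def)
  also have "\<dots> = pair_pmf (p u) (p v)"
    using assms by (simp add: Pi_pmf_component)
  finally show ?thesis .
qed

text \<open>A pivot \<open>x\<close> separates \<open>u\<close> from \<open>v\<close> in the two possible ways with odds \<open>e\<^sup>w\<^sup>(\<^sup>u\<^sup>) : e\<^sup>w\<^sup>(\<^sup>v\<^sup>)\<close>, the weight
  of \<open>x\<close> cancelling.\<close>

lemma bt_split_pmf:
  "do {
     (a, b) \<leftarrow> pair_pmf (bernoulli_pmf (bt_prob w u x)) (bernoulli_pmf (bt_prob w v x));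
     if a = b then bernoulli_pmf (bt_prob w u v) else return_pmf a
   } = bernoulli_pmf (bt_prob w u v)"
proof (rule bool_pmf_eqI)
  have [simp]: "exp (w a) + exp (w b) \<noteq> 0" for a b
    using add_pos_pos[OF exp_gt_zero[of "w a"] exp_gt_zero[of "w b"]] by linarith
  define a b \<sigma> where "a = bt_prob w u x" and "b = bt_prob w v x" and "\<sigma> = bt_prob w u v"
  have odds: "a * (1 - b) * (1 - \<sigma>) = \<sigma> * ((1 - a) * b)"
    unfolding a_def b_def \<sigma>_def bt_prob_commute[symmetric]
    by (simp add: bt_prob_def add.commute[of "exp (w x)"] add.commute[of "exp (w v)" "exp (w u)"]
      mult_ac)
  have bounds: "0 \<le> a" "a \<le> 1" "0 \<le> b" "b \<le> 1" "0 \<le> \<sigma>" "\<sigma> \<le> 1"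
    by (auto simp: a_def b_def \<sigma>_def bt_prob_nonneg bt_prob_le_1)
  have "pmf (do {
     (a, b) \<leftarrow> pair_pmf (bernoulli_pmf a) (bernoulli_pmf b);
     if a = b then bernoulli_pmf \<sigma> else return_pmf a}) True =
     (\<sigma> * b + (1 - b)) * a + \<sigma> * (1 - b) * (1 - a)"
    using bounds by (simp add: pair_pmf_def bind_assoc_pmf bind_return_pmf pmf_bind)
  \<comment> \<open>\<open>odds\<close> rearranges to
    \<open>a * (1 - b) = \<sigma> * (a * (1 - b) + (1 - a) * b)\<close>: the separated case
    contributes \<open>\<sigma>\<close> times its own probability, just as the unseparated case
    does.\<close>
  also have "\<dots> = \<sigma>" using odds by (simp add: algebra_simps)
  finally show "pmf (do {
     (a, b) \<leftarrow> pair_pmf (bernoulli_pmf a) (bernoulli_pmf b);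
     if a = b then bernoulli_pmf \<sigma> else return_pmf a}) True = pmf (bernoulli_pmf \<sigma>) True"
    using bounds by simp
qed

section \<open>Pairwise order in the outputs of QuickSort and PlackettLuce\<close>

lemma set_quicksort_list:
  "finite V \<Longrightarrow> xs \<in> set_pmf (quicksort_list V w) \<Longrightarrow> set xs = V"
proof (induction V w arbitrary: xs rule: quicksort_list.induct)
  case (1 V w)
  show ?case
  proof (cases "V = {}")
    case True
    then show ?thesis using 1 by (simp add: quicksort_list.simps[of "{}"])
  next
    case False
    then obtain p l ys zs where "p \<in> V"
      and l: "l \<in> set_pmf (Pi_pmf (V - {p}) False
                  (\<lambda>v. bernoulli_pmf (exp (w v) / (exp (w v) + exp (w p)))))"
      and ys: "ys \<in> set_pmf (quicksort_list {v \<in> V - {p}. l v} w)"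
      and zs: "zs \<in> set_pmf (quicksort_list {v \<in> V - {p}. \<not> l v} w)"
      and xs: "xs = ys @ p # zs"
      using 1(3,4) by (subst (asm) quicksort_list.simps) auto
    have c: "\<not> (V = {} \<or> infinite V)" and p: "p \<in> set_pmf (pmf_of_set V)"
      using False 1(3) \<open>p \<in> V\<close> by auto
    have "set ys = {v \<in> V - {p}. l v}"
      using 1(1)[OF c p l _ ys] 1(3) by simp
    moreover have "set zs = {v \<in> V - {p}. \<not> l v}"
      using 1(2)[OF c p l ys _ zs] 1(3) by simp
    ultimately show ?thesis using xs \<open>p \<in> V\<close> by auto
  qed
qed

text \<open>Condition on the pivot. If it is \<open>u\<close> or \<open>v\<close>, a single coin of
  the right bias decides the order. Otherwise the pivot either separates the pair or leaves it to
  one recursive call, where the induction hypothesis applies, and \<open>bt_split_pmf\<close>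
  combines the two cases. The conditional law is the same for every pivot, so averaging over the
  pivot preserves it.\<close>

lemma precedes_quicksort_list:
  assumes "finite V" "u \<in> V" "v \<in> V" "u \<noteq> v"
  shows "map_pmf (precedes u v) (quicksort_list V w) = bernoulli_pmf (bt_prob w u v)"
  using assms
proof (induction "card V" arbitrary: V rule: less_induct)
  case less
  let ?P = "\<lambda>p. Pi_pmf (V - {p}) False (\<lambda>v. bernoulli_pmf (bt_prob w v p))"
  let ?L = "\<lambda>p l. {v \<in> V - {p}. l v}" and ?R = "\<lambda>p l. {v \<in> V - {p}. \<not> l v}"
  have fin: "finite (V - {p})" "finite (?L p l)" "finite (?R p l)" for p l
    using less.prems by auto
  have V: "V \<noteq> {}" using less.prems by auto
  have "map_pmf (precedes u v) (quicksort_list V w) =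
      do {p \<leftarrow> pmf_of_set V; l \<leftarrow> ?P p; xs \<leftarrow> quicksort_list (?L p l) w;
          ys \<leftarrow> quicksort_list (?R p l) w; return_pmf (precedes u v (xs @ p # ys))}"
    using V less.prems by (subst quicksort_list.simps) (simp add: map_bind_pmf bt_prob_def)
  also have "\<dots> = do {p \<leftarrow> pmf_of_set V; bernoulli_pmf (bt_prob w u v)}"
  proof (intro bind_pmf_cong refl)
    fix p assume "p \<in> set_pmf (pmf_of_set V)"
    then have p: "p \<in> V" using V less.prems by simp
    have sets: "set xs = ?L p l" "set ys = ?R p l"
      if "xs \<in> set_pmf (quicksort_list (?L p l) w)" "ys \<in> set_pmf (quicksort_list (?R p l) w)"
      for l xs ys
      using set_quicksort_list[OF fin(2) that(1)] set_quicksort_list[OF fin(3) that(2)] by blast+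
    consider (u) "p = u" | (v) "p = v" | (other) "p \<noteq> u" "p \<noteq> v" by blast
    then show "do {l \<leftarrow> ?P p; xs \<leftarrow> quicksort_list (?L p l) w;
          ys \<leftarrow> quicksort_list (?R p l) w; return_pmf (precedes u v (xs @ p # ys))} =
        bernoulli_pmf (bt_prob w u v)"
    proof cases
      case u
      have "do {l \<leftarrow> ?P p; xs \<leftarrow> quicksort_list (?L p l) w;
          ys \<leftarrow> quicksort_list (?R p l) w; return_pmf (precedes u v (xs @ p # ys))} =
        do {l \<leftarrow> ?P p; xs \<leftarrow> quicksort_list (?L p l) w;
          ys \<leftarrow> quicksort_list (?R p l) w; return_pmf (\<not> l v)}"
        using u less.prems
        by (intro bind_pmf_cong refl arg_cong[of _ _ return_pmf])
           (simp add: precedes_append precedes_Cons sets)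
      also have "\<dots> = map_pmf Not (map_pmf (\<lambda>l. l v) (?P p))"
        by (simp add: map_pmf_def bind_assoc_pmf bind_return_pmf)
      also have "\<dots> = bernoulli_pmf (bt_prob w u v)"
        using u less.prems by (simp add: Pi_pmf_component map_Not_bernoulli_pmf bt_prob_nonneg
            bt_prob_le_1 bt_prob_commute[of w u v])
      finally show ?thesis .
    next
      case v
      have "do {l \<leftarrow> ?P p; xs \<leftarrow> quicksort_list (?L p l) w;
          ys \<leftarrow> quicksort_list (?R p l) w; return_pmf (precedes u v (xs @ p # ys))} =
        do {l \<leftarrow> ?P p; xs \<leftarrow> quicksort_list (?L p l) w;
          ys \<leftarrow> quicksort_list (?R p l) w; return_pmf (l u)}"
        using v less.prems
        by (intro bind_pmf_cong refl arg_cong[of _ _ return_pmf])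
           (simp add: precedes_append precedes_Cons sets)
      also have "\<dots> = map_pmf (\<lambda>l. l u) (?P p)"
        by (simp add: map_pmf_def)
      also have "\<dots> = bernoulli_pmf (bt_prob w u v)"
        using v less.prems by (simp add: Pi_pmf_component)
      finally show ?thesis .
    next
      case other
      have IH: "map_pmf (precedes u v) (quicksort_list W w) = bernoulli_pmf (bt_prob w u v)"
        if "W \<subseteq> V - {p}" "u \<in> W" "v \<in> W" for W
        using that p less.prems
        by (intro less.hyps) (auto intro: finite_subset psubset_card_mono)
      have "do {xs \<leftarrow> quicksort_list (?L p l) w;
          ys \<leftarrow> quicksort_list (?R p l) w; return_pmf (precedes u v (xs @ p # ys))} =
        (if l u = l v then bernoulli_pmf (bt_prob w u v) else return_pmf (l u))"
        (is "?lhs = _") for l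
      proof -
        have "?lhs = do {xs \<leftarrow> quicksort_list (?L p l) w; ys \<leftarrow> quicksort_list (?R p l) w;
          return_pmf (if l u = l v then if l u then precedes u v xs else precedes u v ys else l u)}"
          using other less.prems
          by (intro bind_pmf_cong refl arg_cong[of _ _ return_pmf])
             (auto simp: precedes_append precedes_Cons sets)
        \<comment> \<open>A sublist that the returned value does not mention is integrated out, so
          at most one recursive call survives.\<close>
        also have "\<dots> = (if l u = l v then
             if l u then map_pmf (precedes u v) (quicksort_list (?L p l) w)
             else map_pmf (precedes u v) (quicksort_list (?R p l) w) else return_pmf (l u))"
          by (simp add: map_pmf_def)
        also have "\<dots> = (if l u = l v then bernoulli_pmf (bt_prob w u v) else return_pmf (l u))"
          using other less.prems IH[of "?L p l"] IH[of "?R p l"] by auto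
        finally show ?thesis .
      qed
      then have "do {l \<leftarrow> ?P p; xs \<leftarrow> quicksort_list (?L p l) w;
          ys \<leftarrow> quicksort_list (?R p l) w; return_pmf (precedes u v (xs @ p # ys))} =
        do {(a, b) \<leftarrow> map_pmf (\<lambda>l. (l u, l v)) (?P p);
          if a = b then bernoulli_pmf (bt_prob w u v) else return_pmf a}"
        by (simp add: bind_map_pmf)
      also have "\<dots> = bernoulli_pmf (bt_prob w u v)"
        using other less.prems by (simp add: map_Pi_pmf_two_components bt_split_pmf)
      finally show ?thesis .
    qed
  qed
  finally show ?case by simp
qed

text \<open>Condition on the first draw. It settles the order if it hits \<open>u\<close> or
  \<open>v\<close>, which happens with odds \<open>exp (w u) : exp (w v)\<close>, the same odds as
  in the claim; any other draw leaves the question to the induction hypothesis.\<close>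

lemma precedes_plackett_luce_list:
  assumes "finite V" "u \<in> V" "v \<in> V" "u \<noteq> v"
  shows "map_pmf (precedes u v) (plackett_luce_list V w) = bernoulli_pmf (bt_prob w u v)"
  using assms
proof (induction "card V" arbitrary: V rule: less_induct)
  case less
  let ?\<sigma> = "bt_prob w u v" and ?Z = "\<Sum>x\<in>V. exp (w x)"
  have V: "V \<noteq> {}" using less.prems by auto
  have Z: "?Z > 0" using V less.prems by (intro sum_pos) auto
  have "map_pmf (precedes u v) (plackett_luce_list V w) =
      do {x \<leftarrow> exp_choice V w; us \<leftarrow> plackett_luce_list (V - {x}) w;
          return_pmf (precedes u v (x # us))}"
    using V less.prems by (subst plackett_luce_list.simps) (simp add: map_bind_pmf)
  also have "\<dots> = do {x \<leftarrow> exp_choice V w;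
      if x = u then return_pmf True else if x = v then return_pmf False else bernoulli_pmf ?\<sigma>}"
  proof (intro bind_pmf_cong refl)
    fix x assume "x \<in> set_pmf (exp_choice V w)"
    then have x: "x \<in> V" using V less.prems by (simp add: set_pmf_exp_choice)
    have "map_pmf (precedes u v) (plackett_luce_list (V - {x}) w) = bernoulli_pmf ?\<sigma>"
      if "x \<noteq> u" "x \<noteq> v"
      using that x less.prems by (intro less.hyps) (auto intro!: psubset_card_mono
         simp del: card_Diff_insert card_Diff_singleton)
    then show "do {us \<leftarrow> plackett_luce_list (V - {x}) w; return_pmf (precedes u v (x # us))} =
      (if x = u then return_pmf True else if x = v then return_pmf False else bernoulli_pmf ?\<sigma>)"
      using less.prems by (auto simp: precedes_Cons map_pmf_def)
  qed
  also have "\<dots> = bernoulli_pmf ?\<sigma>"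
  proof (rule bool_pmf_eqI)
    let ?f = "\<lambda>x. if x = u then 1 else if x = v then 0 else ?\<sigma>"
    have "pmf (do {x \<leftarrow> exp_choice V w;
        if x = u then return_pmf True else if x = v then return_pmf False else bernoulli_pmf ?\<sigma>})
        True = (\<integral>x. ?f x \<partial>exp_choice V w)"
      unfolding pmf_bind
      by (intro Bochner_Integration.integral_cong) (auto simp: bt_prob_nonneg bt_prob_le_1)
    also have "\<dots> = (\<Sum>x\<in>V. ?f x * pmf (exp_choice V w) x)"
      using V less.prems by (intro integral_measure_pmf_real) (auto simp: set_pmf_exp_choice)
    also have "\<dots> = (\<Sum>x\<in>V. ?f x * exp (w x)) / ?Z"
      using V less.prems by (auto simp: pmf_exp_choice sum_divide_distrib intro!: sum.cong)
    \<comment> \<open>Write \<open>?f\<close> as the constant \<open>?\<sigma>\<close> plus a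
      correction \<open>1 - ?\<sigma>\<close> at \<open>u\<close> and \<open>- ?\<sigma>\<close> at
      \<open>v\<close>. After weighting by \<open>exp (w x)\<close> the two corrections
      cancel.\<close>
    also have "(\<Sum>x\<in>V. ?f x * exp (w x)) = (\<Sum>x\<in>V. ?\<sigma> * exp (w x) +
        (if x = u then (1 - ?\<sigma>) * exp (w u) else 0) + (if x = v then - ?\<sigma> * exp (w v) else 0))"
      using less.prems by (intro sum.cong) (auto simp: algebra_simps)
    also have "\<dots> = ?\<sigma> * ?Z + (1 - ?\<sigma>) * exp (w u) - ?\<sigma> * exp (w v)"
      using less.prems by (simp add: sum.distrib sum_distrib_left)
    also have "(1 - ?\<sigma>) * exp (w u) = ?\<sigma> * exp (w v)"
      by (simp add: bt_prob_commute[symmetric]) (simp add: bt_prob_def add.commute)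
    finally show "pmf (do {x \<leftarrow> exp_choice V w;
        if x = u then return_pmf True else if x = v then return_pmf False else bernoulli_pmf ?\<sigma>})
        True = pmf (bernoulli_pmf ?\<sigma>) True"
      using Z by (simp add: bt_prob_nonneg bt_prob_le_1)
  qed
  finally show ?case .
qed

text \<open>From here on the two procedures enter only through this common pairwise law. The passage
  from lists to rankings adds one to both positions and so keeps their order.\<close>

lemma map_less_sort_proc:
  assumes "finite V" "u \<in> V" "v \<in> V" "u \<noteq> v"
    and "sort_proc = quicksort \<or> sort_proc = plackett_luce"
  shows "map_pmf (\<lambda>\<pi>. \<pi> u < \<pi> v) (sort_proc V w) = bernoulli_pmf (bt_prob w u v)"
proof -
  have "(\<lambda>\<pi>. \<pi> u < \<pi> v) \<circ> list_ranking V = precedes u v"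
    using assms by (auto simp: list_ranking_def precedes_def fun_eq_iff)
  then show ?thesis
    using assms precedes_quicksort_list[of V u v w] precedes_plackett_luce_list[of V u v w]
    by (auto simp: quicksort_def plackett_luce_def pmf.map_comp)
qed

section \<open>Exponential weights on a single pair\<close>

text \<open>Hoeffding's lemma for the log moment generating function of a Bernoulli variable with
  mean \<open>p\<close>. Negative \<open>h\<close> reduces to positive \<open>h\<close> by
  exchanging the two outcomes, which replaces \<open>(h, p)\<close> by \<open>(- h, 1 - p)\<close>
  and pulls out a factor \<open>exp h\<close>.\<close>

lemma ln_bernoulli_mgf_le:
  fixes h p :: real
  assumes "0 \<le> p" "p \<le> 1"
  shows "ln (1 + p * (exp h - 1)) \<le> p * h + h\<^sup>2 / 8"
proof (cases "h \<ge> 0")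
  case True
  then show ?thesis using Hoeffdings_lemma_aux[of h p] assms by (simp add: algebra_simps)
next
  case False
  have pos: "1 + (1 - p) * (exp (- h) - 1) > 0"
    using assms False by (intro add_pos_nonneg mult_nonneg_nonneg) auto
  have "1 + p * (exp h - 1) = exp h * (1 + (1 - p) * (exp (- h) - 1))"
    by (simp add: algebra_simps exp_minus)
  then have "ln (1 + p * (exp h - 1)) = h + ln (1 + (1 - p) * (exp (- h) - 1))"
    using pos by (simp add: ln_mult)
  also have "\<dots> \<le> h + ((1 - p) * (- h) + (- h)\<^sup>2 / 8)"
    using Hoeffdings_lemma_aux[of "- h" "1 - p"] assms False by (simp add: algebra_simps)
  finally show ?thesis by (simp add: algebra_simps)
qed

text \<open>With \<open>x\<close> the weight difference before a step and \<open>h\<close> its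
  increment, the potential grows by exactly \<open>ln (1 + p * (exp h - 1))\<close>, where
  \<open>p = exp x / (1 + exp x)\<close> is the probability of placing \<open>v\<close> first in
  that step. Hoeffding's lemma bounds this growth; the initial zero weights give
  \<open>ln 2\<close>.\<close>

lemma hedge_potential:
  "ln (1 + exp (weights \<eta> s T v - weights \<eta> s T u)) \<le>
     ln 2 + (\<Sum>t=1..T. \<eta> * bt_prob (weights \<eta> s (t - 1)) v u * (s t v - s t u)
              + (\<eta> * (s t v - s t u))\<^sup>2 / 8)"
proof (induction T)
  case 0
  then show ?case by simp
next
  case (Suc T)
  define x where "x = weights \<eta> s T v - weights \<eta> s T u"
  define h where "h = \<eta> * (s (Suc T) v - s (Suc T) u)"
  define p where "p = bt_prob (weights \<eta> s T) v u"
  have p: "0 \<le> p" "p \<le> 1" by (auto simp: p_def bt_prob_nonneg bt_prob_le_1)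
  have px: "p = exp x / (1 + exp x)"
    by (simp add: p_def bt_prob_def x_def exp_diff field_simps add_nonneg_eq_0_iff)
  have "0 < 1 + exp x" by (simp add: add_pos_pos)
  then have eq: "1 + exp (x + h) = (1 + exp x) * (1 + p * (exp h - 1))"
    by (simp add: px exp_add field_simps)
  have "0 < 1 + exp (x + h)" by (simp add: add_pos_pos)
  then have "0 < 1 + p * (exp h - 1)"
    using \<open>0 < 1 + exp x\<close> by (simp add: eq zero_less_mult_iff)
  then have "ln (1 + exp (x + h)) \<le> ln (1 + exp x) + (p * h + h\<^sup>2 / 8)"
    using \<open>0 < 1 + exp x\<close> ln_bernoulli_mgf_le[OF p, of h] by (simp add: eq ln_mult)
  moreover have "weights \<eta> s (Suc T) v - weights \<eta> s (Suc T) u = x + h"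
    by (simp add: x_def h_def algebra_simps)
  ultimately show ?case
    using Suc.IH unfolding x_def[symmetric] by (simp add: h_def p_def algebra_simps)
qed

text \<open>The left-hand side is the regret on the pair against a ranking that places
  \<open>u\<close> before \<open>v\<close>. The potential is nonnegative, so dividing its upper
  bound by \<open>\<eta>\<close> bounds the regret.\<close>

lemma pair_regret:
  assumes "\<eta> > 0"
  shows "(\<Sum>t=1..T. - bt_prob (weights \<eta> s (t - 1)) v u * (s t v - s t u)) \<le>
           ln 2 / \<eta> + \<eta> / 8 * (\<Sum>t=1..T. (s t v - s t u)\<^sup>2)"
proof -
  have "0 \<le> ln (1 + exp (weights \<eta> s T v - weights \<eta> s T u))" by simp
  also note hedge_potential
  finally have "0 \<le> ln 2 + \<eta> * (\<Sum>t=1..T. bt_prob (weights \<eta> s (t - 1)) v u * (s t v - s t u))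
      + \<eta> * \<eta> / 8 * (\<Sum>t=1..T. (s t v - s t u)\<^sup>2)"
    by (simp add: sum.distrib sum_distrib_left power_mult_distrib power2_eq_square[of \<eta>] mult.assoc)
  then have "\<eta> * - (\<Sum>t=1..T. bt_prob (weights \<eta> s (t - 1)) v u * (s t v - s t u)) \<le>
      \<eta> * (ln 2 / \<eta> + \<eta> / 8 * (\<Sum>t=1..T. (s t v - s t u)\<^sup>2))"
    using assms by (simp add: distrib_left)
  with assms show ?thesis
    by (simp only: mult_le_cancel_left_pos sum_negf mult_minus_left)
qed

section \<open>Sums over pairs of items\<close>

text \<open>The ranking \<open>\<pi>\<close> orients every unordered pair. In the regret bound
  \<open>\<pi>\<close> is the comparator, which thus always places the first component first, as
  \<open>pair_regret\<close> requires.\<close>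

lemma sum_ordered_pairs:
  fixes f :: "'a \<Rightarrow> 'a \<Rightarrow> real" and \<pi> :: "'a \<Rightarrow> nat"
  assumes "finite V" "inj_on \<pi> V"
  shows "(\<Sum>(u, v)\<in>{(u, v). u \<in> V \<and> v \<in> V \<and> u \<noteq> v}. f u v) =
           (\<Sum>(u, v)\<in>{(u, v). u \<in> V \<and> v \<in> V \<and> \<pi> u < \<pi> v}. f u v + f v u)"
proof -
  let ?P = "{(u, v). u \<in> V \<and> v \<in> V \<and> \<pi> u < \<pi> v}"
  have fin: "finite ?P" by (rule finite_subset[of _ "V \<times> V"]) (use assms in auto)
  have "{(u, v). u \<in> V \<and> v \<in> V \<and> u \<noteq> v} = ?P \<union> prod.swap ` ?P"
    using assms(2) by (force simp: inj_on_def linorder_neq_iff)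
  also have "(\<Sum>(u, v)\<in>\<dots>. f u v) = (\<Sum>(u, v)\<in>?P. f u v) + (\<Sum>(u, v)\<in>prod.swap ` ?P. f u v)"
    using fin by (intro sum.union_disjoint) auto
  also have "(\<Sum>(u, v)\<in>prod.swap ` ?P. f u v) = (\<Sum>(u, v)\<in>?P. f v u)"
    by (subst sum.reindex) (auto simp: case_prod_unfold)
  finally show ?thesis by (simp add: case_prod_unfold sum.distrib)
qed

lemma card_ordered_pairs_le:
  fixes \<pi> :: "'a \<Rightarrow> nat"
  assumes "finite V" "inj_on \<pi> V"
  shows "real (card {(u, v). u \<in> V \<and> v \<in> V \<and> \<pi> u < \<pi> v}) \<le> (real (card V))\<^sup>2 / 2"
proof -
  have "card {(u, v). u \<in> V \<and> v \<in> V \<and> u \<noteq> v} \<le> card (V \<times> V)"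
    using assms by (intro card_mono) auto
  from of_nat_mono[OF this, where 'a = real]
  have "real (card {(u, v). u \<in> V \<and> v \<in> V \<and> u \<noteq> v}) \<le> (real (card V))\<^sup>2"
    by (simp add: card_cartesian_product power2_eq_square)
  moreover have "real (card {(u, v). u \<in> V \<and> v \<in> V \<and> u \<noteq> v}) =
      2 * real (card {(u, v). u \<in> V \<and> v \<in> V \<and> \<pi> u < \<pi> v})"
    using sum_ordered_pairs[OF assms, of "\<lambda>_ _. 1"] by simp
  ultimately show ?thesis by linarith
qed

text \<open>The sum counts the pairs on which \<open>f\<close> differs. Doubling it gives the sum
  over the full square, since the diagonal vanishes; there \<open>f u * f u = f u\<close> makes the
  summand \<open>f v + f u - 2 * f u * f v\<close>, which can be summed directly.\<close>

lemma sum_sq_diff_ordered_pairs: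
  fixes \<pi> :: "'a \<Rightarrow> nat" and f :: "'a \<Rightarrow> real"
  assumes "finite V" "inj_on \<pi> V" "\<forall>u\<in>V. f u \<in> {0, 1}"
  shows "(\<Sum>(u, v)\<in>{(u, v). u \<in> V \<and> v \<in> V \<and> \<pi> u < \<pi> v}. (f v - f u)\<^sup>2) =
           real (card {u \<in> V. f u = 1}) * (real (card V) - real (card {u \<in> V. f u = 1}))"
    (is "?S = ?k * (_ - _)")
proof -
  have sum_f: "sum f V = ?k"
  proof -
    have "sum f V = (\<Sum>u\<in>V. if f u = 1 then 1 else 0)"
      using assms by (intro sum.cong) auto
    then show ?thesis using assms by (simp add: sum.If_cases Int_def)
  qed
  have sq: "f u * f u = f u" if "u \<in> V" for u using assms that by auto
  have "2 * ?S = (\<Sum>(u, v)\<in>{(u, v). u \<in> V \<and> v \<in> V \<and> u \<noteq> v}. (f v - f u)\<^sup>2)"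
    by (subst sum_ordered_pairs[OF assms(1,2)])
       (auto simp: sum_distrib_left power2_commute intro!: sum.cong)
  also have "\<dots> = (\<Sum>(u, v)\<in>V \<times> V. (f v - f u)\<^sup>2)"
    using assms by (intro sum.mono_neutral_left) auto
  also have "\<dots> = (\<Sum>u\<in>V. \<Sum>v\<in>V. f v + f u - 2 * (f u * f v))"
    by (auto simp: sum.cartesian_product power2_eq_square algebra_simps sq intro!: sum.cong)
  also have "\<dots> = 2 * (?k * (real (card V) - ?k))"
    by (simp add: sum.distrib sum_subtractf sum_f flip: sum_distrib_left sum_distrib_right)
       (simp add: algebra_simps)
  finally show ?thesis by simp
qed

section \<open>Regret of OnlineRank\<close>

text \<open>By linearity of expectation, only the law of the order of one pair in one step matters.
  The shift \<open>t - 1\<close> reflects that step \<open>t\<close> is played before its feedback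
  is seen.\<close>

lemma expectation_total_loss:
  assumes "finite V" and sp: "sort_proc = quicksort \<or> sort_proc = plackett_luce"
  shows "measure_pmf.expectation (online_rank V \<eta> sort_proc s T) (total_loss V s T) =
    (\<Sum>t=1..T. \<Sum>(u, v)\<in>{(u, v). u \<in> V \<and> v \<in> V \<and> u \<noteq> v}.
       bt_prob (weights \<eta> s (t - 1)) u v * max (s t v - s t u) 0)"
proof -
  let ?R = "online_rank V \<eta> sort_proc s T" and ?O = "{(u, v). u \<in> V \<and> v \<in> V \<and> u \<noteq> v}"
  have int: "integrable ?R (\<lambda>\<pi>s. of_bool (\<pi>s t u < \<pi>s t v) * c)"
    for t :: nat and u v and c :: real
    by (rule measure_pmf.integrable_const_bound[where B = "\<bar>c\<bar>"]) auto
  have marginal: "measure_pmf.expectation ?R (\<lambda>\<pi>s. of_bool (\<pi>s t u < \<pi>s t v) * c) =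
      bt_prob (weights \<eta> s (t - 1)) u v * c"
    if "t \<in> {1..T}" "(u, v) \<in> ?O" for t u v and c :: real
  proof -
    have "map_pmf (\<lambda>\<pi>s. \<pi>s t u < \<pi>s t v) ?R =
        map_pmf (\<lambda>\<pi>. \<pi> u < \<pi> v) (map_pmf (\<lambda>\<pi>s. \<pi>s t) ?R)"
      by (simp add: pmf.map_comp o_def)
    also have "\<dots> = bernoulli_pmf (bt_prob (weights \<eta> s (t - 1)) u v)"
      using that assms unfolding online_rank_def
      by (simp add: Pi_pmf_component map_less_sort_proc[OF _ _ _ _ sp])
    finally have *: "map_pmf (\<lambda>\<pi>s. \<pi>s t u < \<pi>s t v) ?R = \<dots>" .
    have "measure_pmf.expectation ?R (\<lambda>\<pi>s. of_bool (\<pi>s t u < \<pi>s t v) * c) =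
        measure_pmf.expectation (map_pmf (\<lambda>\<pi>s. \<pi>s t u < \<pi>s t v) ?R) (\<lambda>b. of_bool b * c)"
      by (simp only: integral_map_pmf)
    then show ?thesis
      by (simp add: * bt_prob_nonneg bt_prob_le_1)
  qed
  have "measure_pmf.expectation ?R (total_loss V s T) =
      (\<Sum>t=1..T. measure_pmf.expectation ?R (\<lambda>\<pi>s. pairwise_loss V (\<pi>s t) (s t)))"
    unfolding total_loss_def pairwise_loss_def case_prod_unfold
    by (intro Bochner_Integration.integral_sum Bochner_Integration.integrable_sum int)
  also have "\<dots> = (\<Sum>t=1..T. \<Sum>p\<in>?O. measure_pmf.expectation ?R
      (\<lambda>\<pi>s. of_bool (\<pi>s t (fst p) < \<pi>s t (snd p)) * max (s t (snd p) - s t (fst p)) 0))"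
    unfolding pairwise_loss_def case_prod_unfold
    by (intro sum.cong refl Bochner_Integration.integral_sum int)
  also have "\<dots> = (\<Sum>t=1..T. \<Sum>(u, v)\<in>?O.
      bt_prob (weights \<eta> s (t - 1)) u v * max (s t v - s t u) 0)"
    unfolding case_prod_unfold by (intro sum.cong refl marginal) auto
  finally show ?thesis .
qed

lemma expected_regret_le:
  fixes \<pi> :: "'a \<Rightarrow> nat"
  assumes fin: "finite V" and inj: "inj_on \<pi> V" and \<eta>: "\<eta> > 0"
    and s01: "\<forall>t\<in>{1..T}. \<forall>u\<in>V. s t u \<in> {0, 1}"
    and sp: "sort_proc = quicksort \<or> sort_proc = plackett_luce"
    and M: "\<And>t. t \<in> {1..T} \<Longrightarrow>
      real (card {u \<in> V. s t u = 1}) * (real (card V) - real (card {u \<in> V. s t u = 1})) \<le> M"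
  shows "measure_pmf.expectation (online_rank V \<eta> sort_proc s T) (total_loss V s T) \<le>
    total_loss V s T (\<lambda>t. \<pi>) + ((real (card V))\<^sup>2 / 2 * (ln 2 / \<eta>) + \<eta> / 8 * (real T * M))"
proof -
  let ?P = "{(u, v). u \<in> V \<and> v \<in> V \<and> \<pi> u < \<pi> v}"
  let ?q = "\<lambda>t. bt_prob (weights \<eta> s (t - 1))"
  have swap: "(\<Sum>t=1..T. \<Sum>(u, v)\<in>?P. g t u v) = (\<Sum>(u, v)\<in>?P. \<Sum>t=1..T. g t u v)"
    for g :: "nat \<Rightarrow> 'a \<Rightarrow> 'a \<Rightarrow> real"
    unfolding case_prod_unfold by (rule sum.swap)
  have "measure_pmf.expectation (online_rank V \<eta> sort_proc s T) (total_loss V s T) -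
      total_loss V s T (\<lambda>t. \<pi>) = (\<Sum>t=1..T. \<Sum>(u, v)\<in>?P. - ?q t v u * (s t v - s t u))"
    unfolding expectation_total_loss[OF fin sp] total_loss_def pairwise_loss_def
      sum_ordered_pairs[OF fin inj] sum_subtractf[symmetric]
  proof (intro sum.cong refl, clarify)
    \<comment> \<open>With \<open>d = s t v - s t u\<close>, the comparator loses the positive part
      of \<open>d\<close> on this pair. Since \<open>?q t u v - 1 = - ?q t v u\<close>, the
      difference is \<open>- ?q t v u\<close> times the positive part minus the negative part of
      \<open>d\<close>, that is \<open>- ?q t v u * d\<close>.\<close>
    fix t u v assume "\<pi> u < \<pi> v"
    then show "?q t u v * max (s t v - s t u) 0 + ?q t v u * max (s t u - s t v) 0 -
        (of_bool (\<pi> u < \<pi> v) * max (s t v - s t u) 0 + of_bool (\<pi> v < \<pi> u) * max (s t u - s t v) 0)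
        = - ?q t v u * (s t v - s t u)"
      by (simp add: bt_prob_commute[of _ v u] max_def algebra_simps)
  qed
  also have "\<dots> = (\<Sum>(u, v)\<in>?P. \<Sum>t=1..T. - ?q t v u * (s t v - s t u))"
    by (rule swap)
  also have "\<dots> \<le> (\<Sum>(u, v)\<in>?P. ln 2 / \<eta> + \<eta> / 8 * (\<Sum>t=1..T. (s t v - s t u)\<^sup>2))"
    using pair_regret[OF \<eta>] by (intro sum_mono) (auto simp del: mult_minus_left)
  also have "\<dots> = real (card ?P) * (ln 2 / \<eta>) +
      \<eta> / 8 * (\<Sum>t=1..T. \<Sum>(u, v)\<in>?P. (s t v - s t u)\<^sup>2)"
    unfolding swap by (simp add: case_prod_unfold sum.distrib sum_distrib_left)
  also have "\<dots> \<le> (real (card V))\<^sup>2 / 2 * (ln 2 / \<eta>) + \<eta> / 8 * (\<Sum>t=1..T. M)"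
  proof (intro add_mono mult_left_mono mult_right_mono sum_mono)
    fix t assume "t \<in> {1..T}"
    then show "(\<Sum>(u, v)\<in>?P. (s t v - s t u)\<^sup>2) \<le> M"
      using M[of t] sum_sq_diff_ordered_pairs[OF fin inj, of "s t"] s01 by simp
  qed (use \<eta> card_ordered_pairs_le[OF fin inj] in auto)
  finally show ?thesis by simp
qed

lemma expected_regret_learning_rate:
  fixes \<pi> :: "'a \<Rightarrow> nat"
  assumes "finite V" "\<pi> \<in> rankings V" "card V = n" "n \<ge> 2" "T \<ge> 1"
    and "\<forall>t\<in>{1..T}. \<forall>u\<in>V. s t u \<in> {0, 1}"
    and "sort_proc = quicksort \<or> sort_proc = plackett_luce" and "M > 0"
    and "\<And>t. t \<in> {1..T} \<Longrightarrow>
      real (card {u \<in> V. s t u = 1}) * (real n - real (card {u \<in> V. s t u = 1})) \<le> M"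
  shows "measure_pmf.expectation (online_rank V (learning_rate n T M) sort_proc s T)
           (total_loss V s T) \<le> total_loss V s T (\<lambda>t. \<pi>) + real n * sqrt (real T * M * ln 2)"
proof -
  let ?\<eta> = "learning_rate n T M"
  define a b where "a = sqrt (real T * M)" and "b = sqrt (ln 2)"
  have a: "a > 0" "real T * M = a * a" and b: "b > 0" "ln 2 = b * b"
    using assms by (auto simp: a_def b_def)
  have \<eta>: "?\<eta> = real n * b / a" by (simp add: learning_rate_def a_def b_def)
  have n: "real n > 0" using assms by simp
  have "inj_on \<pi> V" using assms by (auto simp: rankings_def bij_betw_def)
  moreover have "?\<eta> > 0" using n a b by (simp add: \<eta>)
  ultimately have "measure_pmf.expectation (online_rank V ?\<eta> sort_proc s T) (total_loss V s T) \<le>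
      total_loss V s T (\<lambda>t. \<pi>) + ((real n)\<^sup>2 / 2 * (ln 2 / ?\<eta>) + ?\<eta> / 8 * (real T * M))"
    using expected_regret_le[of V \<pi> ?\<eta> T s sort_proc M] assms by simp
  \<comment> \<open>The first term equals \<open>1 / 2\<close> and the second \<open>1 / 8\<close>
    of \<open>real n * (a * b)\<close>.\<close>
  also have "(real n)\<^sup>2 / 2 * (ln 2 / ?\<eta>) + ?\<eta> / 8 * (real T * M) = 5 / 8 * (real n * (a * b))"
    using n a(1) b(1) unfolding \<eta> a(2) b(2) by (simp add: field_simps power2_eq_square)
  also have "\<dots> \<le> real n * (a * b)"
    using n a b by simp
  also have "a * b = sqrt (real T * M * ln 2)"
    by (simp add: a_def b_def real_sqrt_mult)
  finally show ?thesis by simp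
qed

theorem corollary3p2:
  fixes V :: "'a set" and n T :: nat and s :: "nat \<Rightarrow> 'a \<Rightarrow> real"
    and sort_proc :: "'a set \<Rightarrow> ('a \<Rightarrow> real) \<Rightarrow> ('a \<Rightarrow> nat) pmf"
    and \<pi>opt :: "'a \<Rightarrow> nat"
  assumes "finite V" and "card V = n" and "n \<ge> 2" and "T \<ge> 1"
    and "\<forall>t\<in>{1..T}. \<forall>u\<in>V. s t u \<in> {0, 1}"
    and "sort_proc = quicksort \<or> sort_proc = plackett_luce"
    and "is_arg_min (\<lambda>\<pi>. total_loss V s T (\<lambda>t. \<pi>)) (\<lambda>\<pi>. \<pi> \<in> rankings V) \<pi>opt"
  shows
    "(\<forall>M. real T \<ge> 4 * ln 2 \<and> M = (real n)\<^sup>2 / 4 \<longrightarrow>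
        measure_pmf.expectation (online_rank V (learning_rate n T M) sort_proc s T) (total_loss V s T)
          \<le> total_loss V s T (\<lambda>t. \<pi>opt) + (real n)\<^sup>2 / 2 * sqrt (real T * ln 2))
   \<and> (\<forall>M. \<forall>k::nat. 1 \<le> k \<and> real k \<le> real n / 2 \<and>
        (\<forall>t\<in>{1..T}. card {u \<in> V. s t u = 1} \<le> k) \<and>
        real T \<ge> real n / real k * ln 2 \<and> M = real n * real k \<longrightarrow>
        measure_pmf.expectation (online_rank V (learning_rate n T M) sort_proc s T) (total_loss V s T)
          \<le> total_loss V s T (\<lambda>t. \<pi>opt) + real n powr (3 / 2) * sqrt (real T * real k * ln 2))
   \<and> (\<forall>M. (\<forall>t\<in>{1..T}. card {u \<in> V. s t u = 1} = 1) \<and>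
        real T \<ge> real n * ln 2 \<and> M = real n \<longrightarrow>
        measure_pmf.expectation (online_rank V (learning_rate n T M) sort_proc s T) (total_loss V s T)
          \<le> total_loss V s T (\<lambda>t. \<pi>opt) + real n powr (3 / 2) * sqrt (real T * ln 2))"
proof -
  have \<pi>: "\<pi>opt \<in> rankings V" using assms by (simp add: is_arg_min_def)
  let ?k = "\<lambda>t. card {u \<in> V. s t u = 1}"
  let ?E = "\<lambda>M. measure_pmf.expectation (online_rank V (learning_rate n T M) sort_proc s T)
    (total_loss V s T)"
  have bound: "?E M \<le> total_loss V s T (\<lambda>t. \<pi>opt) + real n * sqrt (real T * M * ln 2)"
    if "M > 0" "\<And>t. t \<in> {1..T} \<Longrightarrow> real (?k t) * (real n - real (?k t)) \<le> M" for M
    using expected_regret_learning_rate[OF assms(1) \<pi> assms(2-6) that] by simp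
  have k_le: "real (?k t) \<le> real n" for t
    using assms by (auto intro!: card_mono)
  \<comment> \<open>The factor \<open>n\<close> inside \<open>M\<close> leaves the root as
    \<open>sqrt n\<close> and joins the outer \<open>n\<close> in the exponent
    \<open>3 / 2\<close>.\<close>
  have n32: "real n * sqrt (real n * x) = real n powr (3 / 2) * sqrt x" for x
  proof -
    have "real n powr (3 / 2) = real n powr (1 + 1 / 2)" by simp
    also have "\<dots> = real n * sqrt (real n)"
      using assms by (subst powr_add) (simp add: powr_half_sqrt)
    finally show ?thesis by (simp add: real_sqrt_mult)
  qed
  have general: "?E ((real n)\<^sup>2 / 4)
      \<le> total_loss V s T (\<lambda>t. \<pi>opt) + (real n)\<^sup>2 / 2 * sqrt (real T * ln 2)"
  proof -
    \<comment> \<open>The number of split pairs is largest when half of the items are chosen; the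
      gap to the maximum is a quarter of \<open>(n - 2 * ?k t)\<close> squared.\<close>
    have "real (?k t) * (real n - real (?k t)) \<le> (real n)\<^sup>2 / 4" for t
      using zero_le_power2[of "real n - 2 * real (?k t)"]
      by (simp add: power2_eq_square algebra_simps)
    then have "?E ((real n)\<^sup>2 / 4) \<le>
        total_loss V s T (\<lambda>t. \<pi>opt) + real n * sqrt (real T * ((real n)\<^sup>2 / 4) * ln 2)"
      using assms by (intro bound) auto
    also have "sqrt (real T * ((real n)\<^sup>2 / 4) * ln 2) = real n / 2 * sqrt (real T * ln 2)"
      by (simp add: real_sqrt_mult real_sqrt_divide)
    finally show ?thesis by (simp add: power2_eq_square)
  qed
  have choice: "?E (real n * real k)
      \<le> total_loss V s T (\<lambda>t. \<pi>opt) + real n powr (3 / 2) * sqrt (real T * real k * ln 2)"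
    if "1 \<le> k" "\<And>t. t \<in> {1..T} \<Longrightarrow> ?k t \<le> k" for k :: nat
  proof -
    have "real (?k t) * (real n - real (?k t)) \<le> real n * real k" if "t \<in> {1..T}" for t
    proof -
      have "real (?k t) * (real n - real (?k t)) \<le> real k * real n"
        using \<open>t \<in> {1..T}\<close> \<open>\<And>t. t \<in> {1..T} \<Longrightarrow> ?k t \<le> k\<close> k_le by (intro mult_mono) auto
      then show ?thesis by (simp add: mult.commute)
    qed
    then have "?E (real n * real k) \<le>
        total_loss V s T (\<lambda>t. \<pi>opt) + real n * sqrt (real T * (real n * real k) * ln 2)"
      using assms that(1) by (intro bound) auto
    also have "real T * (real n * real k) * ln 2 = real n * (real T * real k * ln 2)"
      by simp
    finally show ?thesis by (simp only: n32)
  qed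
  show ?thesis
  proof (intro conjI)
    show "\<forall>M. real T \<ge> 4 * ln 2 \<and> M = (real n)\<^sup>2 / 4 \<longrightarrow>
        ?E M \<le> total_loss V s T (\<lambda>t. \<pi>opt) + (real n)\<^sup>2 / 2 * sqrt (real T * ln 2)"
      using general by fast
  \<comment> \<open>The single choice case is the \<open>k\<close>-choice bound at
    \<open>k = 1\<close>.\<close>
  qed (use choice choice[of 1] in auto)
qed

end
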